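(* For every $M>0$ there is a positive integer $n=n(M)$ with the following property. For any positive real numbers $a,b,c,d$ such that the ratio of any two of them is at most $M$, there exist $t\in[0,a]$ and $r_1,r_2,r_3\in C_n$ such that $$r_1=\frac{t}{b+d},\qquad r_2=\frac{a-t}{b},\qquad r_3=\frac{a+c-t}{d}.$$
   Context: For a positive integer $n$, $C_n$ denotes the set of $n$-aloof numbers: irrational $x>0$ whose continued fraction expansion $x=[a_0;a_1,a_2,\ldots]$ (with $a_0\ge0$, $a_i\ge1$ for $i\ge1$ integers) satisfies $a_i\le n$ for all $i\ge0$. *)

theory Defs
  imports "HOL-Analysis.Analysis"
begin

fun cf_convergent :: "(nat \<Rightarrow> nat) \<Rightarrow> nat \<Rightarrow> real" where
  "cf_convergent a 0 = real (a 0)"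
| "cf_convergent a (Suc k) = real (a 0) + 1 / cf_convergent (\<lambda>i. a (Suc i)) k"

text \<open>\<open>cf_expansion x a\<close> says that \<open>x = [a\<^sub>0; a\<^sub>1, a\<^sub>2, \<dots>]\<close>; the condition \<open>a\<^sub>0 \<ge> 0\<close> is
  built into the type. For irrational \<open>x > 0\<close> there is exactly one such sequence.\<close>

definition cf_expansion :: "real \<Rightarrow> (nat \<Rightarrow> nat) \<Rightarrow> bool" where
  "cf_expansion x a \<longleftrightarrow> (\<forall>i\<ge>1. a i \<ge> 1) \<and> cf_convergent a \<longlonglongrightarrow> x"

definition aloof :: "nat \<Rightarrow> real set" where
  "aloof n = {x. x > 0 \<and> x \<notin> \<rat> \<and> (\<exists>a. cf_expansion x a \<and> (\<forall>i. a i \<le> n))}"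

end

theory Submission
  imports Defs
begin

text \<open>The numbers \<open>r\<^sub>1, r\<^sub>2, r\<^sub>3\<close> are affine functions of \<open>t\<close> whose slopes are comparable to \<open>1/a\<close>.
  An irrational \<open>x > 0\<close> has bounded partial quotients as soon as \<open>\<bar>x - p/q\<bar> \<ge> \<epsilon>/q\<^sup>2\<close> for all fractions
  \<open>p/q\<close>. Such a \<open>t\<close> is found in a nested sequence of intervals of length \<open>a/9\<^sup>k\<close>:
  since distinct fractions with denominators \<open>q, q'\<close> are at least \<open>1/(q q')\<close> apart, the \<open>k\<close>-th interval
  contains, for each of the three functions, at most one point that is sent to a fraction with
  denominator below a constant times \<open>3\<^sup>k\<close>, and three points can be avoided by passing to
  one of four separated subintervals.\<close>

section \<open>Continued fractions of badly approximable numbers\<close>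

text \<open>The classical Gauss map \<open>y \<mapsto> frac (1 / y)\<close> conjugated by inversion.
  In this form its iterates at an irrational \<open>x\<close> are the complete quotients of
  \<open>x\<close>, starting with \<open>x\<close> itself, and every digit, including the zeroth, is
  the floor of an iterate.\<close>

definition gauss_map :: "real \<Rightarrow> real" where
  "gauss_map x = 1 / frac x"

definition cf_digit :: "real \<Rightarrow> nat \<Rightarrow> nat" where
  "cf_digit x i = nat \<lfloor>(gauss_map ^^ i) x\<rfloor>"

lemma cf_digit_0: "cf_digit x 0 = nat \<lfloor>x\<rfloor>"
  by (simp add: cf_digit_def)

lemma cf_digit_Suc: "cf_digit x (Suc i) = cf_digit (gauss_map x) i"
  by (simp add: cf_digit_def funpow_swap1)

lemma gauss_map_irrational:
  assumes "x \<notin> \<rat>"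
  shows "gauss_map x \<notin> \<rat>" "gauss_map x > 1"
proof -
  have "x \<notin> \<int>"
    using assms Ints_subset_Rats by blast
  then have "0 < frac x"
    by (simp add: frac_gt_0_iff)
  moreover have "frac x < 1"
    by (rule frac_lt_1)
  ultimately show "gauss_map x > 1"
    by (simp add: gauss_map_def)
  show "gauss_map x \<notin> \<rat>"
  proof
    assume "gauss_map x \<in> \<rat>"
    then have "inverse (gauss_map x) + of_int \<lfloor>x\<rfloor> \<in> \<rat>"
      by (intro Rats_add Rats_inverse) auto
    then show False
      using assms by (simp add: gauss_map_def frac_def)
  qed
qed

lemma funpow_gauss_map_irrational:
  assumes "x \<notin> \<rat>"
  shows "(gauss_map ^^ k) x \<notin> \<rat>"
  using assms by (induction k) (simp_all add: gauss_map_irrational)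

text \<open>Each digit acts as the integral Moebius map \<open>z \<mapsto> a + 1 / z\<close> of
  determinant -1. Composing the first \<open>Suc k\<close> of them expresses \<open>x\<close>
  through the next complete quotient, and the first column of the product matrix is the convergent.
  The induction peels off the first digit, as the recursion of \<open>cf_convergent\<close> does.
  The new denominator is then the old numerator, so \<open>q \<ge> k\<close> needs the growth of
  numerators for numbers above 1 to be carried along.\<close>

lemma cf_convergent_mobius:
  assumes "x \<notin> \<rat>" "x > 0"
  shows "\<exists>p q p' q' :: nat. q > 0 \<and> q \<ge> k \<and> (x > 1 \<longrightarrow> p \<ge> Suc k) \<and>
    \<bar>int p * int q' - int p' * int q\<bar> = 1 \<and>
    cf_convergent (cf_digit x) k = real p / real q \<and>
    x * (real q * (gauss_map ^^ Suc k) x + real q') = real p * (gauss_map ^^ Suc k) x + real p'"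
  using assms
proof (induction k arbitrary: x)
  case (0 x)
  have g: "gauss_map x > 1"
    using 0 gauss_map_irrational by blast
  have fl: "real (nat \<lfloor>x\<rfloor>) = of_int \<lfloor>x\<rfloor>"
    using 0 by simp
  \<comment> \<open>Division by zero gives 0, so \<open>frac x = 0\<close> would make
    \<open>gauss_map x\<close> equal to 0, contradicting \<open>g\<close>.\<close>
  have "frac x \<noteq> 0"
  proof
    assume "frac x = 0"
    then have "gauss_map x = 0"
      unfolding gauss_map_def by (simp only: div_by_0)
    then show False
      using g by simp
  qed
  then have "frac x * gauss_map x = 1"
    unfolding gauss_map_def by (metis nonzero_mult_div_cancel_left times_divide_eq_right mult_1_right divide_self)
  then have "x * gauss_map x = of_int \<lfloor>x\<rfloor> * gauss_map x + 1"
    by (simp add: frac_def algebra_simps)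
  \<comment> \<open>The witnesses are \<open>p = nat \<lfloor>x\<rfloor>\<close>,
    \<open>q = 1\<close>, \<open>p' = 1\<close> and \<open>q' = 0\<close>; the second pair is the
    formal convergent 1/0 of index -1.\<close>
  then show ?case
    using fl by (intro exI[of _ "nat \<lfloor>x\<rfloor>"] exI[of _ 1] exI[of _ 0])
      (auto simp: cf_digit_0 le_nat_iff)
next
  case (Suc k x)
  define g where "g = gauss_map x"
  define y where "y = (gauss_map ^^ Suc k) g"
  define a where "a = nat \<lfloor>x\<rfloor>"
  have g: "g > 1" "g \<notin> \<rat>"
    using Suc.prems gauss_map_irrational by (auto simp: g_def)
  have y: "(gauss_map ^^ Suc (Suc k)) x = y"
    by (simp add: y_def g_def funpow_swap1)
  obtain p q p' q' :: nat where pq: "q > 0" "p \<ge> Suc k"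
    "\<bar>int p * int q' - int p' * int q\<bar> = 1"
    "cf_convergent (cf_digit g) k = real p / real q"
    "g * (real q * y + real q') = real p * y + real p'"
    using Suc.IH[of g] g unfolding y_def by auto
  have a: "real a = of_int \<lfloor>x\<rfloor>"
    using Suc.prems by (simp add: a_def)
  have x: "x = real a + 1 / g"
    by (simp add: a g_def gauss_map_def frac_def)
  \<comment> \<open>Prepending the digit \<open>a\<close> sends \<open>p / q\<close> to
    \<open>a + q / p\<close>. The new columns are therefore \<open>(a * p + q, p)\<close> and
    \<open>(a * p' + q', p')\<close>, and the determinant only changes sign.\<close>
  have eq: "x * (real p * y + real p') = real a * (real p * y + real p') + (real q * y + real q')"
    using pq(5)[symmetric] g(1) by (simp add: x field_simps)
  have conv: "cf_convergent (cf_digit x) (Suc k) = real (a * p + q) / real p"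
  proof -
    have "cf_convergent (cf_digit x) (Suc k) = real a + 1 / (real p / real q)"
      by (simp add: cf_digit_Suc cf_digit_0 a_def g_def flip: pq(4))
    also have "\<dots> = real (a * p + q) / real p"
      using pq(1,2) by (simp add: field_simps)
    finally show ?thesis .
  qed
  have num: "a * p + q \<ge> Suc (Suc k)" if "x > 1"
  proof -
    have "a \<ge> 1"
      using that by (simp add: a_def le_nat_iff)
    then have "p \<le> a * p"
      by simp
    then show ?thesis
      using pq by linarith
  qed
  have det: "\<bar>int (a * p + q) * int p' - int (a * p' + q') * int p\<bar> = 1"
    using pq(3) by (simp add: algebra_simps abs_minus_commute)
  have "x * (real p * y + real p') = real (a * p + q) * y + real (a * p' + q')"
    unfolding eq by (simp add: algebra_simps)
  moreover have "p > 0"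
    using pq(2) by simp
  ultimately show ?case
    unfolding y using pq(2) conv num det by blast
qed

text \<open>With \<open>y\<close> the next complete quotient,
  \<open>x = (p y + p') / (q y + q')\<close> and determinant 1 or -1 give the exact error
  \<open>1 / (q (q y + q'))\<close>; dropping \<open>q'\<close> yields the bound. The factor
  \<open>y\<close> is kept because it is what turns bad approximability into a bound on the next
  digit.\<close>

lemma cf_convergent_approx:
  assumes "x \<notin> \<rat>" "x > 0"
  obtains p q :: nat where "q > 0" "q \<ge> k" "cf_convergent (cf_digit x) k = real p / real q"
    "\<bar>x - real p / real q\<bar> \<le> 1 / ((real q)\<^sup>2 * (gauss_map ^^ Suc k) x)"
proof -
  define y where "y = (gauss_map ^^ Suc k) x"
  obtain p q p' q' :: nat where pq: "q > 0" "q \<ge> k"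
    "\<bar>int p * int q' - int p' * int q\<bar> = 1"
    "cf_convergent (cf_digit x) k = real p / real q"
    "x * (real q * y + real q') = real p * y + real p'"
    using cf_convergent_mobius[OF assms, of k] unfolding y_def by auto
  have y: "y > 1"
    using gauss_map_irrational(2) funpow_gauss_map_irrational[OF assms(1), of k]
    by (simp add: y_def)
  define D where "D = real q * y + real q'"
  have "real q * y > 0"
    using pq y by simp
  then have D: "D \<ge> real q * y" "D > 0"
    unfolding D_def by auto
  have det: "\<bar>real p * real q' - real p' * real q\<bar> = 1"
    using arg_cong[OF pq(3), of real_of_int] by simp
  have "x * D = real p * y + real p'"
    using pq by (simp add: D_def)
  moreover have "(x - real p / real q) * (real q * D) = real q * (x * D) - real p * D"
    using pq(1) by (simp add: field_simps)
  ultimately have "(x - real p / real q) * (real q * D) = - (real p * real q' - real p' * real q)"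
    by (simp add: D_def algebra_simps)
  then have "x - real p / real q = - (real p * real q' - real p' * real q) / (real q * D)"
    using D pq(1) by (simp add: nonzero_eq_divide_eq)
  then have "\<bar>x - real p / real q\<bar> = 1 / (real q * D)"
    using D pq(1) det by (simp add: abs_mult abs_minus_commute)
  also have "\<dots> \<le> 1 / (real q * (real q * y))"
    using D pq(1) y by (intro divide_left_mono mult_left_mono) auto
  finally show ?thesis
    using that pq by (simp add: y_def power2_eq_square mult.assoc)
qed

text \<open>All iterates after the first exceed 1, which makes the digits positive. Since
  \<open>q \<ge> k\<close>, the error of the \<open>k\<close>-th convergent is at most
  \<open>1 / k\<close>.\<close>

lemma cf_expansion_cf_digit:
  assumes "x \<notin> \<rat>" "x > 0"
  shows "cf_expansion x (cf_digit x)"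
  unfolding cf_expansion_def
proof
  show "\<forall>i\<ge>1. 1 \<le> cf_digit x i"
  proof (intro allI impI)
    fix i :: nat
    assume "i \<ge> 1"
    then obtain j where "i = Suc j"
      by (cases i) auto
    then have "(gauss_map ^^ i) x > 1"
      using gauss_map_irrational(2) funpow_gauss_map_irrational[OF assms(1)] by simp
    then show "1 \<le> cf_digit x i"
      by (simp add: cf_digit_def le_nat_iff)
  qed
  have "norm (cf_convergent (cf_digit x) k - x) \<le> 1 / real k" if k: "k \<ge> 1" for k
  proof -
    obtain p q :: nat where pq: "q > 0" "q \<ge> k"
      "cf_convergent (cf_digit x) k = real p / real q"
      "\<bar>x - real p / real q\<bar> \<le> 1 / ((real q)\<^sup>2 * (gauss_map ^^ Suc k) x)"
      by (rule cf_convergent_approx[OF assms])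
    have "(gauss_map ^^ Suc k) x > 1"
      using gauss_map_irrational(2) funpow_gauss_map_irrational[OF assms(1)] by simp
    then have "real q * 1 \<le> real q * (real q * (gauss_map ^^ Suc k) x)"
      using pq(1) by (intro mult_left_mono) (auto intro: order_trans[OF _ mult_mono[of 1 _ 1]])
    then have "real k \<le> (real q)\<^sup>2 * (gauss_map ^^ Suc k) x"
      using pq(2) by (simp add: power2_eq_square mult.assoc)
    then have "1 / ((real q)\<^sup>2 * (gauss_map ^^ Suc k) x) \<le> 1 / real k"
      using k by (intro divide_left_mono) auto
    then show ?thesis
      using pq(3,4) by (simp add: abs_minus_commute)
  qed
  then have "\<forall>\<^sub>F k in sequentially. norm (cf_convergent (cf_digit x) k - x) \<le> 1 / real k"
    by (rule eventually_sequentiallyI)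
  then have "(\<lambda>k. cf_convergent (cf_digit x) k - x) \<longlonglongrightarrow> 0"
    using lim_1_over_n by (rule Lim_null_comparison)
  then show "cf_convergent (cf_digit x) \<longlonglongrightarrow> x"
    by (simp add: LIM_zero_iff)
qed

text \<open>A rational \<open>x\<close> would violate \<open>bad\<close> at its own fraction, so
  \<open>x\<close> is irrational. The zeroth digit is bounded by \<open>x\<close>. For a later
  digit, comparing \<open>bad\<close> with the error of the preceding convergent bounds the complete
  quotient by \<open>1 / \<epsilon>\<close>, and the digit is its floor.\<close>

lemma aloof_if_badly_approximable:
  assumes "x \<ge> 0" "x \<le> real n" "\<epsilon> > 0" "1 / \<epsilon> \<le> real n"
    and bad: "\<And>p q::int. q > 0 \<Longrightarrow> \<epsilon> / (of_int q)\<^sup>2 \<le> \<bar>x - of_int p / of_int q\<bar>"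
  shows "x \<in> aloof n"
proof -
  have irr: "x \<notin> \<rat>"
  proof
    assume "x \<in> \<rat>"
    then obtain p q :: int where "q > 0" "x = of_int p / of_int q"
      by (auto elim: Rats_cases')
    then show False
      using bad[of q p] \<open>\<epsilon> > 0\<close> by (simp add: field_simps)
  qed
  then have pos: "x > 0"
    using \<open>x \<ge> 0\<close> by (cases "x = 0") auto
  have "cf_digit x i \<le> n" for i
  proof (cases i)
    case 0
    then show ?thesis
      using \<open>x \<le> real n\<close> by (simp add: cf_digit_0) linarith
  next
    case (Suc k)
    define y where "y = (gauss_map ^^ Suc k) x"
    have y: "y > 1"
      using gauss_map_irrational(2) funpow_gauss_map_irrational[OF irr] by (simp add: y_def)
    obtain p q :: nat where pq: "q > 0"
      "\<bar>x - real p / real q\<bar> \<le> 1 / ((real q)\<^sup>2 * y)"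
      using cf_convergent_approx[OF irr pos, of k] unfolding y_def by metis
    have "\<epsilon> / (real q)\<^sup>2 \<le> 1 / ((real q)\<^sup>2 * y)"
      using bad[of "int q" "int p"] pq by simp
    then have "y \<le> 1 / \<epsilon>"
      using pq(1) y \<open>\<epsilon> > 0\<close> by (simp add: field_simps)
    then have "y \<le> real n"
      using assms(4) by simp
    then show ?thesis
      unfolding cf_digit_def Suc y_def[symmetric] by linarith
  qed
  then show ?thesis
    using irr pos cf_expansion_cf_digit unfolding aloof_def by blast
qed

section \<open>Simultaneous bad approximability\<close>

lemma subinterval_avoiding_points:
  fixes u h :: real
  assumes "finite P" "card P \<le> N" "h > 0"
  obtains v where "u + h \<le> v" "v + h \<le> u + (2 * real N + 3) * h - h"
    "\<And>w z. w \<in> {v..v+h} \<Longrightarrow> z \<in> P \<Longrightarrow> h / 2 \<le> \<bar>w - z\<bar>"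
proof -
  define v where "v j = u + (2 * real j + 1) * h" for j :: nat
  have "\<exists>j\<le>N. \<forall>w\<in>{v j..v j + h}. \<forall>z\<in>P. h / 2 \<le> \<bar>w - z\<bar>"
  proof (rule ccontr)
    assume "\<not> ?thesis"
    then have "\<forall>j\<in>{..N}. \<exists>z\<in>P. \<exists>w\<in>{v j..v j + h}. \<bar>w - z\<bar> < h / 2"
      by (meson atMost_iff not_le)
    then obtain z where z: "\<And>j. j \<le> N \<Longrightarrow> z j \<in> P"
      "\<And>j. j \<le> N \<Longrightarrow> \<exists>w\<in>{v j..v j + h}. \<bar>w - z j\<bar> < h / 2"
      by (metis atMost_iff)
    have "z i \<noteq> z j" if ij: "i < j" "j \<le> N" for i j
    proof
      assume eq: "z i = z j"
      have "(2 * real i + 3) * h \<le> (2 * real j + 1) * h"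
        using ij \<open>h > 0\<close> by (intro mult_right_mono) auto
      then have "v i + 2 * h \<le> v j"
        by (simp add: v_def algebra_simps)
      moreover obtain w where "w \<in> {v i..v i + h}" "\<bar>w - z i\<bar> < h / 2"
        using z(2)[of i] ij by auto
      moreover obtain w' where "w' \<in> {v j..v j + h}" "\<bar>w' - z j\<bar> < h / 2"
        using z(2)[OF ij(2)] by blast
      ultimately show False
        using eq unfolding atLeastAtMost_iff by linarith
    qed
    then have "inj_on z {..N}"
      by (metis atMost_iff inj_onI linorder_neqE_nat)
    then have "card {..N} \<le> card P"
      using z(1) \<open>finite P\<close> by (intro card_inj_on_le) auto
    then show False
      using \<open>card P \<le> N\<close> by simp
  qed
  then obtain j where j: "j \<le> N" "\<And>w z. w \<in> {v j..v j + h} \<Longrightarrow> z \<in> P \<Longrightarrow> h / 2 \<le> \<bar>w - z\<bar>"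
    by blast
  have "(1::real) * h \<le> (2 * real j + 1) * h" "(2 * real j + 3) * h \<le> (2 * real N + 3) * h"
    using j \<open>h > 0\<close> by (intro mult_right_mono; simp)+
  then show ?thesis
    using j(2) by (intro that[of "v j"]) (simp_all add: v_def algebra_simps)
qed

lemma distinct_fractions_gap:
  fixes p q p' q' :: int
  assumes "q > 0" "q' > 0" "real_of_int p / of_int q \<noteq> of_int p' / of_int q'"
  shows "1 / (of_int q * of_int q') \<le> \<bar>real_of_int p / of_int q - of_int p' / of_int q'\<bar>"
proof -
  have "p * q' - p' * q \<noteq> 0"
    using assms by (auto simp: field_simps simp flip: of_int_mult)
  then have "1 \<le> \<bar>p * q' - p' * q\<bar>"
    by linarith
  then have "1 \<le> \<bar>real_of_int (p * q' - p' * q)\<bar>"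
    by linarith
  moreover have "real_of_int p / of_int q - of_int p' / of_int q' =
      of_int (p * q' - p' * q) / (of_int q * of_int q')"
    using assms by (simp add: field_simps)
  ultimately show ?thesis
    using assms by (simp add: abs_mult divide_right_mono)
qed

text \<open>The bound is put on the squared denominator so that \<open>1 / B\<close> is itself a
  separation scale for the set.\<close>

definition small_fractions :: "real \<Rightarrow> real set" where
  "small_fractions B = {of_int p / of_int q |p q :: int. q > 0 \<and> (of_int q)\<^sup>2 < B}"

text \<open>Distinct fractions differ by at least \<open>1 / (q q')\<close>, and
  \<open>q q' \<le> (q^2 + q'^2) / 2 < B\<close>.\<close>

lemma small_fractions_unique:
  assumes "x \<in> small_fractions B" "y \<in> small_fractions B" "\<bar>x - y\<bar> \<le> 1 / B"
  shows "x = y"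
proof (rule ccontr)
  assume "x \<noteq> y"
  from assms(1,2) obtain p q p' q' :: int where *:
    "x = of_int p / of_int q" "y = of_int p' / of_int q'" "q > 0" "q' > 0"
    "(of_int q)\<^sup>2 < B" "(of_int q')\<^sup>2 < B"
    unfolding small_fractions_def by blast
  have "2 * (real_of_int q * of_int q') \<le> (of_int q)\<^sup>2 + (of_int q')\<^sup>2"
    using sum_squares_bound[of "real_of_int q" "of_int q'"] by simp
  then have "real_of_int q * of_int q' < B"
    using * by linarith
  then have "1 / B < 1 / (real_of_int q * of_int q')"
    using * by (intro divide_strict_left_mono mult_pos_pos) (auto intro: le_less_trans[OF zero_le_power2])
  then show False
    using distinct_fractions_gap[of q q' p p'] * \<open>x \<noteq> y\<close> assms(3) by simp
qed

text \<open>Each affine map stretches the interval to length at most \<open>1 / B\<close>, so it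
  hits at most one small fraction, and at only one point because the slope is nonzero. This leaves
  at most \<open>card I\<close> points to avoid, which fixes the ratio \<open>R\<close>. Distances
  from their preimages are then scaled by the slope.\<close>

lemma subinterval_avoiding_small_fractions:
  fixes s c :: "'i \<Rightarrow> real"
  assumes "finite I" "L > 0" "B > 0"
    and s: "\<And>i. i \<in> I \<Longrightarrow> s i \<noteq> 0" "\<And>i. i \<in> I \<Longrightarrow> \<bar>s i\<bar> * L \<le> 1 / B"
    and R: "R = 2 * real (card I) + 3"
  obtains v where "{v..v + L / R} \<subseteq> {u..u + L}"
    "\<And>w i r. w \<in> {v..v + L / R} \<Longrightarrow> i \<in> I \<Longrightarrow> r \<in> small_fractions B \<Longrightarrow>
      \<bar>s i\<bar> * (L / (2 * R)) \<le> \<bar>s i * w + c i - r\<bar>"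
proof -
  define h where "h = L / R"
  have "R > 0"
    by (simp add: R)
  then have h: "h > 0" "R * h = L"
    using \<open>L > 0\<close> by (auto simp: h_def)
  define T where "T i = {z \<in> {u..u + L}. s i * z + c i \<in> small_fractions B}" for i
  have T: "finite (T i) \<and> card (T i) \<le> 1" if i: "i \<in> I" for i
  proof -
    have "y = z" if "y \<in> T i" "z \<in> T i" for y z
    proof -
      have "\<bar>s i\<bar> * \<bar>y - z\<bar> \<le> \<bar>s i\<bar> * L"
        using that by (intro mult_left_mono) (auto simp: T_def)
      then have "\<bar>(s i * y + c i) - (s i * z + c i)\<bar> \<le> 1 / B"
        using s(2)[OF i] by (simp add: right_diff_distrib flip: abs_mult)
      then have "s i * y + c i = s i * z + c i"
        using that by (intro small_fractions_unique[of _ B]) (auto simp: T_def)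
      then show ?thesis
        using s(1)[OF i] by simp
    qed
    then have "T i = {} \<or> (\<exists>z. T i = {z})"
      by blast
    then show ?thesis
      by auto
  qed
  have "card (\<Union>i\<in>I. T i) \<le> (\<Sum>i\<in>I. card (T i))"
    using \<open>finite I\<close> by (rule card_UN_le)
  also have "\<dots> \<le> (\<Sum>i\<in>I. 1)"
    using T by (intro sum_mono) auto
  finally have "card (\<Union>i\<in>I. T i) \<le> card I"
    by simp
  moreover have "finite (\<Union>i\<in>I. T i)"
    using T \<open>finite I\<close> by blast
  ultimately obtain v where v: "u + h \<le> v" "v + h \<le> u + L - h"
    "\<And>w z. w \<in> {v..v+h} \<Longrightarrow> z \<in> (\<Union>i\<in>I. T i) \<Longrightarrow> h / 2 \<le> \<bar>w - z\<bar>"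
    using subinterval_avoiding_points[of "\<Union>i\<in>I. T i" "card I" h u] h R by metis
  show ?thesis
  proof (rule that[of v])
    show "{v..v + L / R} \<subseteq> {u..u + L}"
      using v h by (auto simp flip: h_def)
    fix w i r
    assume *: "w \<in> {v..v + L / R}" "i \<in> I" "r \<in> small_fractions B"
    define z where "z = (r - c i) / s i"
    have z: "s i * z + c i = r"
      using s(1)[OF *(2)] by (simp add: z_def)
    have "h / 2 \<le> \<bar>w - z\<bar>"
    proof (cases "z \<in> {u..u + L}")
      case True
      then show ?thesis
        using v(3) * z by (auto simp: T_def h_def)
    next
      \<comment> \<open>A preimage outside the interval is further than \<open>h\<close> away,
        because the chosen cell keeps a margin \<open>h\<close> from both ends.\<close>
      case False
      then show ?thesis
        using v(1,2) h(1) *(1) by (auto simp flip: h_def)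
    qed
    then have "\<bar>s i\<bar> * (h / 2) \<le> \<bar>s i\<bar> * \<bar>w - z\<bar>"
      by (intro mult_left_mono) auto
    also have "\<dots> = \<bar>s i * w + c i - r\<bar>"
      unfolding z[symmetric] by (simp add: algebra_simps flip: abs_mult)
    finally show "\<bar>s i\<bar> * (L / (2 * R)) \<le> \<bar>s i * w + c i - r\<bar>"
      by (simp add: h_def mult.commute)
  qed
qed

text \<open>The preceding lemma is iterated on nested intervals of length \<open>A / R ^ k\<close>.
  At level \<open>k\<close> the images have length at most \<open>K / R ^ k\<close>, so fractions
  with squared denominator below \<open>R ^ k / K\<close> can be avoided, by a distance of order
  \<open>1 / R ^ k\<close>. Every fraction is treated at the first level that covers its
  denominator.\<close>

lemma simultaneously_badly_approximable:
  fixes s c :: "'i \<Rightarrow> real"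
  assumes "finite I" "A > 0" "K \<ge> 1" "m > 0"
    and s: "\<And>i. i \<in> I \<Longrightarrow> m \<le> \<bar>s i\<bar> * A" "\<And>i. i \<in> I \<Longrightarrow> \<bar>s i\<bar> * A \<le> K"
    and R: "R = 2 * real (card I) + 3"
  obtains t where "t \<in> {u..u + A}"
    "\<And>i p q::int. i \<in> I \<Longrightarrow> q > 0 \<Longrightarrow>
      m / (2 * R\<^sup>2 * K) / (of_int q)\<^sup>2 \<le> \<bar>s i * t + c i - of_int p / of_int q\<bar>"
proof -
  have R1: "R > 1"
    by (simp add: R)
  have s0: "s i \<noteq> 0" if "i \<in> I" for i
    using s(1)[OF that] \<open>m > 0\<close> by auto
  define F where "F k v = {v..v + A / R ^ k}" for k v
  have "\<exists>v. \<forall>k. (k = 0 \<longrightarrow> v 0 = u) \<and> (F (Suc k) (v (Suc k)) \<subseteq> F k (v k) \<and>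
      (\<forall>w\<in>F (Suc k) (v (Suc k)). \<forall>i\<in>I. \<forall>r\<in>small_fractions (R ^ k / K).
        \<bar>s i\<bar> * (A / (2 * R ^ Suc k)) \<le> \<bar>s i * w + c i - r\<bar>))"
  proof -
    have "\<exists>v'. F (Suc k) v' \<subseteq> F k v \<and>
      (\<forall>w\<in>F (Suc k) v'. \<forall>i\<in>I. \<forall>r\<in>small_fractions (R ^ k / K).
        \<bar>s i\<bar> * (A / (2 * R ^ Suc k)) \<le> \<bar>s i * w + c i - r\<bar>)" for k v
    proof -
      have "\<bar>s i\<bar> * (A / R ^ k) \<le> 1 / (R ^ k / K)" if "i \<in> I" for i
        using s(2)[OF that] R1 by (simp add: divide_right_mono)
      moreover have "A / R ^ k > 0" "R ^ k / K > 0"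
        using \<open>A > 0\<close> \<open>K \<ge> 1\<close> R1 by auto
      ultimately obtain v' where "{v'..v' + A / R ^ k / R} \<subseteq> {v..v + A / R ^ k}"
        "\<And>w i r. w \<in> {v'..v' + A / R ^ k / R} \<Longrightarrow> i \<in> I \<Longrightarrow> r \<in> small_fractions (R ^ k / K) \<Longrightarrow>
          \<bar>s i\<bar> * (A / R ^ k / (2 * R)) \<le> \<bar>s i * w + c i - r\<bar>"
        using subinterval_avoiding_small_fractions[OF \<open>finite I\<close>, of "A / R ^ k" "R ^ k / K" s R v c]
          s0 R by blast
      then show ?thesis
        by (intro exI[of _ v']) (auto simp: F_def mult.commute mult.left_commute)
    qed
    then show ?thesis
      using dependent_nat_choice[of "\<lambda>k v. k = 0 \<longrightarrow> v = u"
        "\<lambda>k v v'. F (Suc k) v' \<subseteq> F k v \<and>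
          (\<forall>w\<in>F (Suc k) v'. \<forall>i\<in>I. \<forall>r\<in>small_fractions (R ^ k / K).
            \<bar>s i\<bar> * (A / (2 * R ^ Suc k)) \<le> \<bar>s i * w + c i - r\<bar>)"] by auto
  qed
  then obtain v where v: "v 0 = u" "\<And>k. F (Suc k) (v (Suc k)) \<subseteq> F k (v k)"
    "\<And>k w i r. w \<in> F (Suc k) (v (Suc k)) \<Longrightarrow> i \<in> I \<Longrightarrow> r \<in> small_fractions (R ^ k / K) \<Longrightarrow>
        \<bar>s i\<bar> * (A / (2 * R ^ Suc k)) \<le> \<bar>s i * w + c i - r\<bar>"
    by metis
  have "\<Inter>(range (\<lambda>k. F k (v k))) \<noteq> {}"
  proof (rule compact_nest)
    show "compact (F k (v k))" "F k (v k) \<noteq> {}" for k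
      using \<open>A > 0\<close> R1 by (auto simp: F_def)
    show "F n (v n) \<subseteq> F k (v k)" if "k \<le> n" for k n
      using lift_Suc_antimono_le[of "\<lambda>k. F k (v k)", OF v(2) that] .
  qed
  then obtain t where t: "\<And>k. t \<in> F k (v k)"
    by blast
  show ?thesis
  proof (rule that[of t])
    show "t \<in> {u..u + A}"
      using t[of 0] v(1) by (simp add: F_def)
    fix i and p q :: int
    assume i: "i \<in> I" and q: "q > 0"
    define Q where "Q = (real_of_int q)\<^sup>2 * K"
    have "(real_of_int q)\<^sup>2 \<ge> 1"
      using q by simp
    then have Q: "Q \<ge> 1"
      unfolding Q_def using mult_mono[of 1 "(real_of_int q)\<^sup>2" 1 K] \<open>K \<ge> 1\<close> by simp
    \<comment> \<open>The first level whose small fractions include denominator \<open>q\<close>.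
      Minimality gives \<open>R ^ (k - 1) \<le> Q\<close>, so the distance obtained is not much
      smaller than \<open>1 / q^2\<close>; \<open>Q \<ge> 1\<close> excludes
      \<open>k = 0\<close>.\<close>
    define k where "k = (LEAST k. Q < R ^ k)"
    have "\<exists>k. Q < R ^ k"
      using real_arch_pow[OF R1] .
    then have k: "Q < R ^ k"
      unfolding k_def by (rule LeastI_ex)
    with Q obtain j where j: "k = Suc j"
      by (cases k) auto
    then have "R ^ j \<le> Q"
      using not_less_Least[of j "\<lambda>k. Q < R ^ k"] by (simp add: k_def not_less)
    have "(real_of_int q)\<^sup>2 < R ^ k / K"
      using k \<open>K \<ge> 1\<close> by (simp add: Q_def field_simps)
    then have "of_int p / of_int q \<in> small_fractions (R ^ k / K)"
      using q by (auto simp: small_fractions_def)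
    then have "\<bar>s i\<bar> * (A / (2 * R ^ Suc k)) \<le> \<bar>s i * t + c i - of_int p / of_int q\<bar>"
      by (rule v(3)[OF t i])
    moreover have "m / (2 * R\<^sup>2 * K) / (of_int q)\<^sup>2 = m / (2 * R\<^sup>2 * Q)"
      by (simp add: Q_def mult_ac)
    \<comment> \<open>Interval \<open>Suc k\<close> has length \<open>A / R ^ Suc k\<close>, and
      \<open>Suc k = j + 2\<close> accounts for the factor \<open>R^2\<close> in the
      constant.\<close>
    moreover have "m / (2 * R\<^sup>2 * Q) \<le> (\<bar>s i\<bar> * A) / (2 * R\<^sup>2 * R ^ j)"
      using \<open>R ^ j \<le> Q\<close> s(1)[OF i] R1 \<open>m > 0\<close> by (intro frac_le mult_left_mono) auto
    moreover have "\<dots> = \<bar>s i\<bar> * (A / (2 * R ^ Suc k))"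
      by (simp add: j power2_eq_square mult_ac)
    ultimately show "m / (2 * R\<^sup>2 * K) / (of_int q)\<^sup>2 \<le> \<bar>s i * t + c i - of_int p / of_int q\<bar>"
      by linarith
  qed
qed

section \<open>Application to the three quotients\<close>

theorem theorem8:
  fixes M :: real
  assumes "M > 0"
  shows "\<exists>n::nat. n > 0 \<and>
    (\<forall>a b c d :: real. a > 0 \<longrightarrow> b > 0 \<longrightarrow> c > 0 \<longrightarrow> d > 0 \<longrightarrow>
      (\<forall>x\<in>{a, b, c, d}. \<forall>y\<in>{a, b, c, d}. x / y \<le> M) \<longrightarrow>
      (\<exists>t\<in>{0..a}. \<exists>r1\<in>aloof n. \<exists>r2\<in>aloof n. \<exists>r3\<in>aloof n.
        r1 = t / (b + d) \<and> r2 = (a - t) / b \<and> r3 = (a + c - t) / d))"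
proof -
  \<comment> \<open>This is \<open>m / (2 * R^2 * K)\<close> for three affine maps:
    \<open>R = 2 * 3 + 3 = 9\<close>, with \<open>m = 1 / (2 * M)\<close> and \<open>K = M\<close>
    bounding the slopes times \<open>a\<close>. In \<open>n\<close>, the term \<open>2 * M\<close>
    bounds the quotients themselves and \<open>1 / \<epsilon>\<close> their later digits.\<close>
  define \<epsilon> where "\<epsilon> = 1 / (2 * M) / (2 * 9\<^sup>2 * M)"
  define n where "n = nat \<lceil>2 * M + 1 / \<epsilon>\<rceil>"
  have \<epsilon>: "\<epsilon> > 0"
    using assms by (simp add: \<epsilon>_def)
  then have "2 * M + 1 / \<epsilon> > 0"
    using assms by (simp add: add_pos_pos)
  then have n: "n > 0" "2 * M + 1 / \<epsilon> \<le> real n"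
    unfolding n_def by linarith+
  have nb: "2 * M \<le> real n" "1 / \<epsilon> \<le> real n"
    using n(2) assms \<epsilon> by (smt (verit) divide_pos_pos)+
  have "\<exists>t\<in>{0..a}. \<exists>r1\<in>aloof n. \<exists>r2\<in>aloof n. \<exists>r3\<in>aloof n.
        r1 = t / (b + d) \<and> r2 = (a - t) / b \<and> r3 = (a + c - t) / d"
    if pos: "a > 0" "b > 0" "c > 0" "d > 0"
      and ratio: "\<forall>x\<in>{a, b, c, d}. \<forall>y\<in>{a, b, c, d}. x / y \<le> M" for a b c d :: real
  proof -
    have le: "x \<le> M * y" if "x \<in> {a, b, c, d}" "y \<in> {a, b, c, d}" for x y
    proof -
      have "x / y \<le> M" "y > 0"
        using ratio that pos by blast+
      then show ?thesis
        by (simp add: divide_le_eq)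
    qed
    have "M \<ge> 1"
      using ratio pos by auto
    have Mpos: "M * a > 0" "M * b > 0" "M * c > 0" "M * d > 0"
      using pos assms by simp_all
    \<comment> \<open>Slopes \<open>s\<close> and intercepts \<open>e\<close> of \<open>r1\<close>,
      \<open>r2\<close>, \<open>r3\<close> as functions of \<open>t\<close>, indexed by 0, 1,
      2.\<close>
    define s where "s = (\<lambda>i::nat. if i = 0 then 1 / (b + d) else if i = 1 then - 1 / b else - 1 / d)"
    define e where "e = (\<lambda>i::nat. if i = 0 then 0 else if i = 1 then a / b else (a + c) / d)"
    define I where "I = {0, 1, 2 :: nat}"
    have I: "finite I" "9 = 2 * real (card I) + 3"
      by (simp_all add: I_def)
    \<comment> \<open>The factor 2 in the lower bound comes from the first slope, since
      \<open>b + d \<le> 2 * M * a\<close>.\<close>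
    have lower: "1 / (2 * M) \<le> \<bar>s i\<bar> * a" and upper: "\<bar>s i\<bar> * a \<le> M" if "i \<in> I" for i
    proof -
      have "b \<le> M * a" "d \<le> M * a" "a \<le> M * b" "a \<le> M * d"
        using le by auto
      then show "1 / (2 * M) \<le> \<bar>s i\<bar> * a" "\<bar>s i\<bar> * a \<le> M"
        using that pos assms Mpos by (auto simp: I_def s_def field_simps)
    qed
    have m: "1 / (2 * M) > 0"
      using assms by simp
    obtain t where t: "t \<in> {0..0 + a}"
      "\<And>i p q::int. i \<in> I \<Longrightarrow> q > 0 \<Longrightarrow>
        \<epsilon> / (of_int q)\<^sup>2 \<le> \<bar>s i * t + e i - of_int p / of_int q\<bar>"
      by (rule simultaneously_badly_approximable
          [OF I(1) pos(1) \<open>M \<ge> 1\<close> m lower upper I(2), where u = 0 and c = e, folded \<epsilon>_def]) blast+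
    have t0: "0 \<le> t" "t \<le> a"
      using t(1) by auto
    have "a \<le> M * b" "a \<le> M * d" "c \<le> M * d"
      using le by auto
    \<comment> \<open>The third quotient dictates the constant \<open>2 * M\<close>, through
      \<open>a + c \<le> 2 * M * d\<close>.\<close>
    then have le2: "t \<le> 2 * M * (b + d)" "a - t \<le> 2 * M * b" "a + c - t \<le> 2 * M * d"
      using t0 Mpos by (auto simp: algebra_simps)
    have "t / (b + d) \<in> aloof n"
    proof (rule aloof_if_badly_approximable[OF _ _ \<epsilon> nb(2)])
      show "0 \<le> t / (b + d)"
        using t0 pos by simp
      have "t / (b + d) \<le> 2 * M"
        using le2 pos by (simp add: divide_le_eq)
      then show "t / (b + d) \<le> real n"
        using nb by linarith
      show "\<epsilon> / (of_int q)\<^sup>2 \<le> \<bar>t / (b + d) - of_int p / of_int q\<bar>" if "q > 0" for p q :: int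
        using t(2)[of 0 q p] that by (simp add: s_def e_def I_def)
    qed
    moreover have "(a - t) / b \<in> aloof n"
    proof (rule aloof_if_badly_approximable[OF _ _ \<epsilon> nb(2)])
      show "0 \<le> (a - t) / b"
        using t0 pos by simp
      have "(a - t) / b \<le> 2 * M"
        using le2 pos by (simp add: divide_le_eq)
      then show "(a - t) / b \<le> real n"
        using nb by linarith
      show "\<epsilon> / (of_int q)\<^sup>2 \<le> \<bar>(a - t) / b - of_int p / of_int q\<bar>" if "q > 0" for p q :: int
        using t(2)[of 1 q p] that by (simp add: s_def e_def I_def diff_divide_distrib)
    qed
    moreover have "(a + c - t) / d \<in> aloof n"
    proof (rule aloof_if_badly_approximable[OF _ _ \<epsilon> nb(2)])
      show "0 \<le> (a + c - t) / d"
        using t0 pos by simp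
      have "(a + c - t) / d \<le> 2 * M"
        using le2 pos by (simp add: divide_le_eq)
      then show "(a + c - t) / d \<le> real n"
        using nb by linarith
      show "\<epsilon> / (of_int q)\<^sup>2 \<le> \<bar>(a + c - t) / d - of_int p / of_int q\<bar>" if "q > 0" for p q :: int
        using t(2)[of 2 q p] that by (simp add: s_def e_def I_def diff_divide_distrib)
    qed
    ultimately show ?thesis
      using t0 by auto
  qed
  then show ?thesis
    using n(1) by blast
qed

end
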